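(* For every $2<p<\infty$, the space $JT_{2,p}$ is reflexive.
   Context: $\mathbb N=\{1,2,\dots\}$. Fix a partial order $\preceq$ on $\mathbb N$, compatible with the usual order ($n\preceq m$ implies $n\le m$), defining an infinitely branching tree without root: the predecessors of each element are linearly ordered, there are infinitely many minimal elements, and every element has infinitely many immediate successors. A segment is a set $\{k\in\mathbb N: m\preceq k\preceq n\}$ with $m\preceq n$. $c_{00}(\mathbb N)$ is the space of finitely supported real sequences. For $2<p<\infty$, $JT_{2,p}$ is the completion of $c_{00}(\mathbb N)$ under the norm $$\|x\|=\sup\Big\{\Big(\sum_{k=1}^n\Big(\sum_{i\in s_k}x(i)^2\Big)^{p/2}\Big)^{1/p}: n\in\mathbb N,\ s_1,\dots,s_n \text{ pairwise disjoint segments}\Big\}.$$ *)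

theory Defs
  imports "HOL-Analysis.Analysis" "HOL-Library.Disjoint_Sets"
begin

section \<open>Trees on the positive integers\<close>

text \<open>The positive integers are the subset \<open>{1..}\<close> of type \<^typ>\<open>nat\<close>; the order \<open>m \<preceq> n\<close> is
  \<open>(m, n) \<in> r\<close>.\<close>

definition tree_predecessors :: "nat rel \<Rightarrow> nat \<Rightarrow> nat set" where
  "tree_predecessors r n = {m. (m, n) \<in> r}"

definition tree_minimals :: "nat rel \<Rightarrow> nat set" where
  "tree_minimals r = {n\<in>{1..}. \<forall>m. (m, n) \<in> r \<longrightarrow> m = n}"

definition immediate_successors :: "nat rel \<Rightarrow> nat \<Rightarrow> nat set" where
  "immediate_successors r n =
     {m. (n, m) \<in> r \<and> m \<noteq> n \<and> (\<forall>k. (n, k) \<in> r \<and> (k, m) \<in> r \<longrightarrow> k = n \<or> k = m)}"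

definition infinitely_branching_rootless_tree :: "nat rel \<Rightarrow> bool" where
  "infinitely_branching_rootless_tree r \<longleftrightarrow>
     partial_order_on {1..} r \<and>
     (\<forall>n m. (n, m) \<in> r \<longrightarrow> n \<le> m) \<and>
     (\<forall>n\<in>{1..}. total_on (tree_predecessors r n) r) \<and>
     infinite (tree_minimals r) \<and>
     (\<forall>n\<in>{1..}. infinite (immediate_successors r n))"

definition tree_segment :: "nat rel \<Rightarrow> nat set \<Rightarrow> bool" where
  "tree_segment r s \<longleftrightarrow> (\<exists>m n. (m, n) \<in> r \<and> s = {k. (m, k) \<in> r \<and> (k, n) \<in> r})"

section \<open>The James tree norm on finitely supported sequences\<close>

text \<open>Sequences are indexed by \<open>{1..}\<close>, so the irrelevant value at index 0 is fixed to be 0.\<close>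

definition c00 :: "(nat \<Rightarrow> real) set" where
  "c00 = {x. x 0 = 0 \<and> finite {i. x i \<noteq> 0}}"

definition JT_values :: "nat rel \<Rightarrow> real \<Rightarrow> (nat \<Rightarrow> real) \<Rightarrow> real set" where
  "JT_values r p x =
     {(\<Sum>k=1..n. (\<Sum>i\<in>s k. (x i)\<^sup>2) powr (p / 2)) powr (1 / p) | (n::nat) s.
        n \<ge> 1 \<and> (\<forall>k\<in>{1..n}. tree_segment r (s k)) \<and> disjoint_family_on s {1..n}}"

definition JT_norm :: "nat rel \<Rightarrow> real \<Rightarrow> (nat \<Rightarrow> real) \<Rightarrow> real" where
  "JT_norm r p x = Sup (JT_values r p x)"

text \<open>The supremum is taken over a nonempty set that is bounded above.\<close>

lemma finite_tree_segment:
  assumes "infinitely_branching_rootless_tree r" "tree_segment r s"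
  shows "finite s"
proof -
  obtain m n where "s = {k. (m, k) \<in> r \<and> (k, n) \<in> r}"
    using assms(2) by (auto simp: tree_segment_def)
  then have "s \<subseteq> {..n}"
    using assms(1) by (auto simp: infinitely_branching_rootless_tree_def)
  then show ?thesis
    using finite_subset by blast
qed

lemma JT_values_nonempty:
  assumes "infinitely_branching_rootless_tree r"
  shows "JT_values r p x \<noteq> {}"
proof -
  have "(1, 1) \<in> r"
    using assms
    by (auto simp: infinitely_branching_rootless_tree_def partial_order_on_def preorder_on_def
        refl_on_def)
  then have "tree_segment r {k. (1, k) \<in> r \<and> (k, 1) \<in> r}"
    unfolding tree_segment_def by blast
  then have "(\<Sum>k=1..1::nat. (\<Sum>i\<in>{k. (1, k) \<in> r \<and> (k, 1) \<in> r}. (x i)\<^sup>2) powr (p / 2)) powr (1 / p)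
      \<in> JT_values r p x"
    unfolding JT_values_def
    by (intro CollectI exI[of _ "1::nat"] exI[of _ "\<lambda>_. {k. (1, k) \<in> r \<and> (k, 1) \<in> r}"])
      (auto simp: disjoint_family_on_def)
  then show ?thesis
    by blast
qed

lemma bdd_above_JT_values:
  assumes r: "infinitely_branching_rootless_tree r" and p: "2 < p" and x: "x \<in> c00"
  shows "bdd_above (JT_values r p x)"
proof -
  define F where "F = {i. x i \<noteq> 0}"
  define A where "A = (\<Sum>i\<in>F. (x i)\<^sup>2)"
  have F: "finite F"
    using x by (simp add: F_def c00_def)
  have A0: "A \<ge> 0"
    by (simp add: A_def sum_nonneg)
  have "v \<le> (A powr (p / 2 - 1) * A) powr (1 / p)" if vin: "v \<in> JT_values r p x" for v
  proof -
    obtain n :: nat and s where v: "v = (\<Sum>k=1..n. (\<Sum>i\<in>s k. (x i)\<^sup>2) powr (p / 2)) powr (1 / p)"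
      and s: "\<And>k. k \<in> {1..n} \<Longrightarrow> tree_segment r (s k)" and d: "disjoint_family_on s {1..n}"
      using vin unfolding JT_values_def by blast
    have fin: "finite (s k)" if "k \<in> {1..n}" for k
      using finite_tree_segment[OF r s[OF that]] .
    define a where "a k = (\<Sum>i\<in>s k. (x i)\<^sup>2)" for k
    have a0: "a k \<ge> 0" for k
      by (simp add: a_def sum_nonneg)
    have "(\<Sum>k=1..n. a k) = (\<Sum>i\<in>(\<Union>k\<in>{1..n}. s k). (x i)\<^sup>2)"
      unfolding a_def using fin d by (subst sum.UNION_disjoint) (auto simp: disjoint_family_on_def)
    also have "\<dots> = (\<Sum>i\<in>(\<Union>k\<in>{1..n}. s k) \<inter> F. (x i)\<^sup>2)"
      by (rule sum.mono_neutral_right) (use fin in \<open>auto simp: F_def\<close>)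
    also have "\<dots> \<le> A"
      unfolding A_def by (rule sum_mono2) (use F in auto)
    finally have sa: "(\<Sum>k=1..n. a k) \<le> A" .
    have aA: "a k \<le> A" if "k \<in> {1..n}" for k
      using member_le_sum[OF that, of a] a0 sa by force
    have le: "a k powr (p / 2) \<le> A powr (p / 2 - 1) * a k" if "k \<in> {1..n}" for k
    proof -
      have "a k powr (p / 2) = a k powr (p / 2 - 1) * a k powr 1"
        unfolding powr_add[symmetric] by simp
      also have "\<dots> = a k powr (p / 2 - 1) * a k"
        using a0[of k] by simp
      also have "\<dots> \<le> A powr (p / 2 - 1) * a k"
        using aA[OF that] a0[of k] p by (intro mult_right_mono powr_mono2) auto
      finally show ?thesis .
    qed
    have "(\<Sum>k=1..n. a k powr (p / 2)) \<le> (\<Sum>k=1..n. A powr (p / 2 - 1) * a k)"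
      by (rule sum_mono) (rule le)
    also have "\<dots> \<le> A powr (p / 2 - 1) * A"
      using sa by (simp flip: sum_distrib_left add: mult_left_mono)
    finally show ?thesis
      unfolding v a_def[symmetric] using p by (intro powr_mono2) (auto intro: sum_nonneg)
  qed
  then show ?thesis
    by (auto simp: bdd_above_def)
qed

section \<open>Completion and reflexivity\<close>

text \<open>\<open>J\<close> exhibits the Banach space \<^typ>\<open>'a\<close> as the completion of \<^const>\<open>c00\<close> under
  \<^term>\<open>JT_norm r p\<close>: it is a linear isometry with dense range. This determines \<^typ>\<open>'a\<close> up to
  isometric isomorphism.\<close>

definition is_JT_completion :: "nat rel \<Rightarrow> real \<Rightarrow> ((nat \<Rightarrow> real) \<Rightarrow> 'a::banach) \<Rightarrow> bool" where
  "is_JT_completion r p J \<longleftrightarrow>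
     (\<forall>x\<in>c00. \<forall>y\<in>c00. J (\<lambda>i. x i + y i) = J x + J y) \<and>
     (\<forall>c. \<forall>x\<in>c00. J (\<lambda>i. c * x i) = c *\<^sub>R J x) \<and>
     (\<forall>x\<in>c00. norm (J x) = JT_norm r p x) \<and>
     closure (J ` c00) = UNIV"

definition canonical_embedding ::
    "'a::real_normed_vector \<Rightarrow> (('a \<Rightarrow>\<^sub>L real) \<Rightarrow>\<^sub>L real)" where
  "canonical_embedding x = Blinfun (\<lambda>f. blinfun_apply f x)"

lemma canonical_embedding_apply [simp]:
  "blinfun_apply (canonical_embedding x) f = blinfun_apply f x"
  unfolding canonical_embedding_def
  by (rule bounded_linear_Blinfun_apply[THEN fun_cong]) (rule blinfun.bounded_linear_left)

definition reflexive_space :: "'a::real_normed_vector itself \<Rightarrow> bool" where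
  "reflexive_space _ \<longleftrightarrow>
     surj (canonical_embedding :: 'a \<Rightarrow> (('a \<Rightarrow>\<^sub>L real) \<Rightarrow>\<^sub>L real))"

end

theory Submission
  imports Defs
begin

text \<open>The norm satisfies two estimates. For disjointly supported vectors it has an upper 2-estimate
  (Minkowski in \<open>\<ell>\<^bsub>p/2\<^esub>\<close>), so the unit vector basis is shrinking. For successive blocks it has a
  lower \<open>p\<close>-estimate, because segments may be truncated to disjoint intervals of the usual order, so
  the basis is boundedly complete. James' argument then applies: for \<open>\<phi>\<close> in the bidual the values
  \<open>\<phi> (coord n)\<close> are the coefficients of a vector \<open>x\<close>, and \<open>\<phi>\<close> and \<open>x\<close> agree on the dense span of the
  coordinate functionals. Explicit functionals norming finitely supported vectors replace the
  Hahn-Banach theorem.\<close>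

section \<open>Inequalities for finite sums\<close>

text \<open>Dividing each factor by its norm reduces the claim to Young's inequality term by term,
  whose right-hand sides then add up to 1/p + 1/q = 1. If one norm vanishes, so does every
  product.\<close>

lemma Holder_sum:
  fixes a b :: "'i \<Rightarrow> real"
  assumes pq: "p > 1" "q > 1" "1/p + 1/q = 1"
    and a: "\<And>k. k \<in> I \<Longrightarrow> a k \<ge> 0" and b: "\<And>k. k \<in> I \<Longrightarrow> b k \<ge> 0" and I: "finite I"
  shows "(\<Sum>k\<in>I. a k * b k) \<le> (\<Sum>k\<in>I. a k powr p) powr (1/p) * (\<Sum>k\<in>I. b k powr q) powr (1/q)"
proof -
  define A where "A = (\<Sum>k\<in>I. a k powr p) powr (1/p)"
  define B where "B = (\<Sum>k\<in>I. b k powr q) powr (1/q)"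
  have A: "A powr p = (\<Sum>k\<in>I. a k powr p)" and B: "B powr q = (\<Sum>k\<in>I. b k powr q)"
    using pq by (simp_all add: A_def B_def powr_powr sum_nonneg)
  have AB0: "A \<ge> 0" "B \<ge> 0"
    by (simp_all add: A_def B_def)
  show ?thesis
  proof (cases "A = 0 \<or> B = 0")
    case True
    then have "(\<Sum>k\<in>I. a k powr p) = 0 \<or> (\<Sum>k\<in>I. b k powr q) = 0"
      using A B by auto
    then have "(\<forall>k\<in>I. a k = 0) \<or> (\<forall>k\<in>I. b k = 0)"
      using I by (auto simp: sum_nonneg_eq_0_iff)
    then have "(\<Sum>k\<in>I. a k * b k) = 0"
      by (intro sum.neutral) auto
    then show ?thesis
      by simp
  next
    case False
    with AB0 have AB: "A > 0" "B > 0"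
      by auto
    have "(\<Sum>k\<in>I. a k / A * (b k / B)) \<le> (\<Sum>k\<in>I. (a k / A) powr p / p + (b k / B) powr q / q)"
      using pq a b AB by (intro sum_mono Youngs_inequality) auto
    also have "\<dots> = (\<Sum>k\<in>I. a k powr p) / A powr p / p + (\<Sum>k\<in>I. b k powr q) / B powr q / q"
      using a b AB by (simp add: sum.distrib sum_divide_distrib powr_divide)
    also have "\<dots> = 1"
      using pq AB by (simp flip: A B)
    finally have "(\<Sum>k\<in>I. a k * b k) / (A * B) \<le> 1"
      by (simp add: sum_divide_distrib)
    then show ?thesis
      using AB by (simp add: A_def[symmetric] B_def[symmetric] divide_le_eq)
  qed
qed

text \<open>For positive arguments this is convexity of the power function. When one argument is 0
  it reduces to \<open>c powr q \<le> c\<close> for c in [0,1].\<close>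

lemma powr_convex_combination:
  fixes u v :: real
  assumes q: "q \<ge> 1" and t: "0 \<le> t" "t \<le> 1" and uv: "u \<ge> 0" "v \<ge> 0"
  shows "((1 - t) * u + t * v) powr q \<le> (1 - t) * u powr q + t * v powr q"
proof -
  have scaled: "(c * w) powr q \<le> c * w powr q" if "0 \<le> c" "c \<le> 1" "w \<ge> 0" for c w :: real
  proof -
    have "c powr q \<le> c"
      using powr_mono'[of 1 q c] q that by simp
    then show ?thesis
      using that by (simp add: powr_mult mult_right_mono)
  qed
  consider "u = 0" | "v = 0" | "u > 0" "v > 0"
    using uv by fastforce
  then show ?thesis
  proof cases
    case 1
    then show ?thesis
      using scaled[of t v] t uv by simp
  next
    case 2
    then show ?thesis
      using scaled[of "1 - t" u] t uv by simp
  next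
    case 3
    then show ?thesis
      using convex_onD[OF powr_convex[OF q], of t u v] t by simp
  qed
qed

text \<open>The quotient (a + b)/(\<alpha> + \<beta>) is the convex combination of a/\<alpha> and
  b/\<beta> with weights \<alpha>/(\<alpha> + \<beta>) and \<beta>/(\<alpha> + \<beta>), so
  convexity of the q-th power applies termwise. Upper bounds \<alpha>, \<beta> replace the exact
  norms, so that squares of James tree norms can be inserted directly.\<close>

lemma Minkowski_sum_le:
  fixes a b :: "'i \<Rightarrow> real"
  assumes q: "q \<ge> 1" and I: "finite I" and \<alpha>: "\<alpha> \<ge> 0" and \<beta>: "\<beta> \<ge> 0"
    and a: "\<And>k. k \<in> I \<Longrightarrow> a k \<ge> 0" and b: "\<And>k. k \<in> I \<Longrightarrow> b k \<ge> 0"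
    and sa: "(\<Sum>k\<in>I. a k powr q) \<le> \<alpha> powr q" and sb: "(\<Sum>k\<in>I. b k powr q) \<le> \<beta> powr q"
  shows "(\<Sum>k\<in>I. (a k + b k) powr q) \<le> (\<alpha> + \<beta>) powr q"
proof -
  have zero: "c k = 0" if "(\<Sum>k\<in>I. c k powr q) \<le> 0" "k \<in> I" for c :: "'i \<Rightarrow> real" and k
  proof -
    have "(\<Sum>k\<in>I. c k powr q) = 0"
      using that(1) by (simp add: order_antisym sum_nonneg)
    then show ?thesis
      using that(2) I by (simp add: sum_nonneg_eq_0_iff)
  qed
  consider "\<alpha> = 0" | "\<beta> = 0" | "\<alpha> > 0" "\<beta> > 0"
    using \<alpha> \<beta> by fastforce
  then show ?thesis
  proof cases
    case 1
    then have "a k = 0" if "k \<in> I" for k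
      using sa zero[of a] that by simp
    then show ?thesis
      using sb 1 by simp
  next
    case 2
    then have "b k = 0" if "k \<in> I" for k
      using sb zero[of b] that by simp
    then show ?thesis
      using sa 2 by simp
  next
    case 3
    define t where "t = \<alpha> / (\<alpha> + \<beta>)"
    have t: "0 \<le> t" "t \<le> 1" "1 - t = \<beta> / (\<alpha> + \<beta>)"
      using 3 by (auto simp: t_def field_simps)
    have "((a k + b k) / (\<alpha> + \<beta>)) powr q \<le> t * (a k / \<alpha>) powr q + (1 - t) * (b k / \<beta>) powr q"
      if "k \<in> I" for k
    proof -
      have "(a k + b k) / (\<alpha> + \<beta>) = (1 - t) * (b k / \<beta>) + t * (a k / \<alpha>)"
        using 3 unfolding t(3) by (simp add: t_def add_divide_distrib)
      then show ?thesis
        using t 3 a[OF that] b[OF that] powr_convex_combination[OF q, of t "b k / \<beta>" "a k / \<alpha>"]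
        by simp
    qed
    then have "(\<Sum>k\<in>I. ((a k + b k) / (\<alpha> + \<beta>)) powr q)
        \<le> (\<Sum>k\<in>I. t * (a k / \<alpha>) powr q + (1 - t) * (b k / \<beta>) powr q)"
      by (rule sum_mono)
    also have "\<dots> = t * ((\<Sum>k\<in>I. a k powr q) / \<alpha> powr q) + (1 - t) * ((\<Sum>k\<in>I. b k powr q) / \<beta> powr q)"
      using a b 3 by (simp add: sum.distrib sum_distrib_left sum_divide_distrib powr_divide)
    also have "\<dots> \<le> t * 1 + (1 - t) * 1"
      using sa sb t 3 by (intro add_mono mult_left_mono) auto
    finally have "(\<Sum>k\<in>I. (a k + b k) powr q) / (\<alpha> + \<beta>) powr q \<le> 1"
      using a b 3 by (simp add: sum_divide_distrib powr_divide)
    then show ?thesis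
      using 3 by (simp add: divide_le_eq)
  qed
qed

section \<open>The norm on finitely supported sequences\<close>

definition restrict_seq :: "nat set \<Rightarrow> (nat \<Rightarrow> real) \<Rightarrow> nat \<Rightarrow> real" where
  "restrict_seq A x = (\<lambda>i. if i \<in> A then x i else 0)"

text \<open>This is the p-th power of a member of \<open>JT_values\<close>. The index type is
  arbitrary so that two families can be merged over a disjoint sum of index sets.\<close>

definition block_sum :: "real \<Rightarrow> 'i set \<Rightarrow> ('i \<Rightarrow> nat set) \<Rightarrow> (nat \<Rightarrow> real) \<Rightarrow> real" where
  "block_sum p I s x = (\<Sum>k\<in>I. (\<Sum>i\<in>s k. (x i)\<^sup>2) powr (p / 2))"

lemma block_sum_nonneg: "block_sum p I s x \<ge> 0"
  by (simp add: block_sum_def sum_nonneg)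

lemma c00_add: "x \<in> c00 \<Longrightarrow> y \<in> c00 \<Longrightarrow> (\<lambda>i. x i + y i) \<in> c00"
  unfolding c00_def by (auto intro: finite_subset[of _ "{i. x i \<noteq> 0} \<union> {i. y i \<noteq> 0}"])

lemma c00_scale: "x \<in> c00 \<Longrightarrow> (\<lambda>i. c * x i) \<in> c00"
  unfolding c00_def by (auto intro: finite_subset[of _ "{i. x i \<noteq> 0}"])

lemma c00_diff: "x \<in> c00 \<Longrightarrow> y \<in> c00 \<Longrightarrow> (\<lambda>i. x i - y i) \<in> c00"
  using c00_add[of x "\<lambda>i. (-1) * y i"] c00_scale[of y "-1"] by simp

lemma c00_restrict: "x \<in> c00 \<Longrightarrow> restrict_seq A x \<in> c00"
  unfolding c00_def restrict_seq_def by (auto intro: finite_subset[of _ "{i. x i \<noteq> 0}"])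

lemma c00_restrict_finite: "x 0 = 0 \<Longrightarrow> finite A \<Longrightarrow> restrict_seq A x \<in> c00"
  unfolding c00_def restrict_seq_def by (auto intro: finite_subset[of _ A])

lemma c00_zero: "(\<lambda>_. 0) \<in> c00"
  by (simp add: c00_def)

lemma restrict_restrict: "restrict_seq A (restrict_seq B x) = restrict_seq (A \<inter> B) x"
  by (auto simp: restrict_seq_def)

locale james_tree =
  fixes r :: "nat rel" and p :: real
  assumes tree: "infinitely_branching_rootless_tree r" and p: "2 < p"
begin

section \<open>Order facts and truncation of segments\<close>

lemma r_refl: "n \<ge> 1 \<Longrightarrow> (n, n) \<in> r"
  and r_trans: "(l, m) \<in> r \<Longrightarrow> (m, n) \<in> r \<Longrightarrow> (l, n) \<in> r"
  and r_antisym: "(m, n) \<in> r \<Longrightarrow> (n, m) \<in> r \<Longrightarrow> m = n"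
  and r_le: "(m, n) \<in> r \<Longrightarrow> m \<le> n"
  and r_pos: "(m, n) \<in> r \<Longrightarrow> m \<ge> 1 \<and> n \<ge> 1"
  using tree unfolding infinitely_branching_rootless_tree_def partial_order_on_def preorder_on_def
    refl_on_def trans_def antisym_def by auto

lemma r_linear: "(k, n) \<in> r \<Longrightarrow> (l, n) \<in> r \<Longrightarrow> (k, l) \<in> r \<or> (l, k) \<in> r"
  using tree r_pos[of k n] r_pos[of l n] r_refl[of k]
  unfolding infinitely_branching_rootless_tree_def total_on_def tree_predecessors_def by force

text \<open>The tree order and the usual order agree on a segment.\<close>

lemma tree_segment_Int:
  assumes s: "tree_segment r s" and A: "\<And>a b k. a \<in> A \<Longrightarrow> b \<in> A \<Longrightarrow> a \<le> k \<Longrightarrow> k \<le> b \<Longrightarrow> k \<in> A"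
    and ne: "s \<inter> A \<noteq> {}"
  shows "tree_segment r (s \<inter> A)"
proof -
  obtain m n where mn: "(m, n) \<in> r" and s_eq: "s = {k. (m, k) \<in> r \<and> (k, n) \<in> r}"
    using s by (auto simp: tree_segment_def)
  have fin: "finite (s \<inter> A)"
    using finite_tree_segment[OF tree s] by blast
  define m' where "m' = Min (s \<inter> A)"
  define n' where "n' = Max (s \<inter> A)"
  have m': "m' \<in> s" "m' \<in> A" and n': "n' \<in> s" "n' \<in> A"
    using Min_in[OF fin ne] Max_in[OF fin ne] by (auto simp: m'_def n'_def)
  \<comment> \<open>Both elements precede \<open>n\<close>, hence are comparable in the tree, and
    compatibility with the usual order fixes the direction.\<close>
  have rle: "(k, l) \<in> r" if "k \<in> s" "l \<in> s" "k \<le> l" for k l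
  proof (cases "(k, l) \<in> r")
    case False
    then have "(l, k) \<in> r"
      using that r_linear[of k n l] by (auto simp: s_eq)
    then have "k = l"
      using r_le that(3) by fastforce
    then show ?thesis
      using \<open>(l, k) \<in> r\<close> by simp
  qed auto
  have "s \<inter> A = {k. (m', k) \<in> r \<and> (k, n') \<in> r}"
  proof (intro set_eqI iffI)
    fix k
    assume k: "k \<in> s \<inter> A"
    then have "m' \<le> k" "k \<le> n'"
      using fin by (auto simp: m'_def n'_def)
    then show "k \<in> {k. (m', k) \<in> r \<and> (k, n') \<in> r}"
      using rle m' n' k by auto
  next
    fix k
    assume k: "k \<in> {k. (m', k) \<in> r \<and> (k, n') \<in> r}"
    then have "k \<in> s"
      using m' n' r_trans unfolding s_eq by blast
    moreover have "k \<in> A"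
      using k m' n' A[of m' n' k] r_le by auto
    ultimately show "k \<in> s \<inter> A"
      by simp
  qed
  moreover have "(m', n') \<in> r"
    using m' n' rle fin ne by (simp add: m'_def n'_def)
  ultimately show ?thesis
    unfolding tree_segment_def by blast
qed

section \<open>Passing between the norm and families of segments\<close>

lemma JT_norm_nonneg:
  assumes "x \<in> c00" shows "JT_norm r p x \<ge> 0"
proof -
  obtain v where v: "v \<in> JT_values r p x"
    using JT_values_nonempty[OF tree] by blast
  then have "v \<ge> 0"
    by (auto simp: JT_values_def)
  then show ?thesis
    unfolding JT_norm_def using cSup_upper2[OF v _ bdd_above_JT_values[OF tree p assms]] by simp
qed

lemma block_sum_le_JT_norm:
  assumes x: "x \<in> c00" and I: "finite I" and d: "disjoint_family_on s I"
    and s: "\<And>k. k \<in> I \<Longrightarrow> s k = {} \<or> tree_segment r (s k)"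
  shows "block_sum p I s x \<le> JT_norm r p x powr p"
proof -
  define I' where "I' = {k\<in>I. s k \<noteq> {}}"
  have I': "finite I'" "I' \<subseteq> I"
    using I by (auto simp: I'_def)
  have eq: "block_sum p I s x = block_sum p I' s x"
    unfolding block_sum_def by (rule sum.mono_neutral_right) (use I in \<open>auto simp: I'_def\<close>)
  show ?thesis
  proof (cases "I' = {}")
    case True
    then show ?thesis
      by (simp add: eq) (simp add: block_sum_def)
  next
    case False
    obtain h where h: "bij_betw h {1..card I'} I'"
      using ex_bij_betw_nat_finite_1[OF I'(1)] by blast
    have hI: "h k \<in> I'" if "k \<in> {1..card I'}" for k
      using bij_betwE[OF h] that by blast
    have "disjoint_family_on (\<lambda>k. s (h k)) {1..card I'}"
      using d hI I' bij_betw_imp_inj_on[OF h]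
      unfolding disjoint_family_on_def inj_on_def by blast
    moreover have "\<forall>k\<in>{1..card I'}. tree_segment r (s (h k))"
      using s hI unfolding I'_def by blast
    moreover have "1 \<le> card I'"
      using False I'(1) by (simp add: Suc_le_eq card_gt_0_iff)
    ultimately have "block_sum p {1..card I'} (\<lambda>k. s (h k)) x powr (1 / p) \<in> JT_values r p x"
      unfolding JT_values_def block_sum_def
      by (intro CollectI exI[of _ "card I'"] exI[of _ "\<lambda>k. s (h k)"]) simp
    then have "block_sum p {1..card I'} (\<lambda>k. s (h k)) x powr (1 / p) \<le> JT_norm r p x"
      unfolding JT_norm_def using bdd_above_JT_values[OF tree p x] by (rule cSup_upper)
    also have "block_sum p {1..card I'} (\<lambda>k. s (h k)) x = block_sum p I s x"
      unfolding eq unfolding block_sum_def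
      using sum.reindex_bij_betw[OF h, of "\<lambda>k. (\<Sum>i\<in>s k. (x i)\<^sup>2) powr (p / 2)"] .
    finally have "(block_sum p I s x powr (1 / p)) powr p \<le> JT_norm r p x powr p"
      using p by (intro powr_mono2) auto
    then show ?thesis
      using p by (simp add: powr_powr block_sum_nonneg)
  qed
qed

lemma JT_norm_powr_le:
  assumes x: "x \<in> c00" and t: "t \<ge> 0"
    and le: "\<And>n s. (\<And>k. k \<in> {1..n::nat} \<Longrightarrow> tree_segment r (s k)) \<Longrightarrow> disjoint_family_on s {1..n} \<Longrightarrow>
      block_sum p {1..n} s x \<le> t"
  shows "JT_norm r p x powr p \<le> t"
proof -
  have "v \<le> t powr (1 / p)" if vin: "v \<in> JT_values r p x" for v
  proof -
    obtain n s where v: "v = block_sum p {1..n::nat} s x powr (1 / p)"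
      and "\<forall>k\<in>{1..n}. tree_segment r (s k)" "disjoint_family_on s {1..n}"
      using vin unfolding JT_values_def block_sum_def by blast
    then have "block_sum p {1..n} s x \<le> t"
      using le by blast
    then show ?thesis
      unfolding v using p block_sum_nonneg by (intro powr_mono2) auto
  qed
  then have "JT_norm r p x \<le> t powr (1 / p)"
    unfolding JT_norm_def by (intro cSup_least JT_values_nonempty[OF tree])
  then have "JT_norm r p x powr p \<le> (t powr (1 / p)) powr p"
    using p JT_norm_nonneg[OF x] by (intro powr_mono2) auto
  then show ?thesis
    using p t by (simp add: powr_powr)
qed

lemma JT_norm_le:
  assumes x: "x \<in> c00" and t: "t \<ge> 0"
    and le: "\<And>n s. (\<And>k. k \<in> {1..n::nat} \<Longrightarrow> tree_segment r (s k)) \<Longrightarrow> disjoint_family_on s {1..n} \<Longrightarrow>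
      block_sum p {1..n} s x \<le> t powr p"
  shows "JT_norm r p x \<le> t"
proof -
  have "JT_norm r p x powr p \<le> t powr p"
    using le by (intro JT_norm_powr_le[OF x]) auto
  then show ?thesis
    using p t powr_less_mono2[of p t "JT_norm r p x"] by fastforce
qed

lemma JT_norm_mono:
  assumes x: "x \<in> c00" and y: "y \<in> c00" and le: "\<And>i. \<bar>x i\<bar> \<le> \<bar>y i\<bar>"
  shows "JT_norm r p x \<le> JT_norm r p y"
proof (rule JT_norm_le[OF x JT_norm_nonneg[OF y]])
  fix n s assume s: "\<And>k. k \<in> {1..n::nat} \<Longrightarrow> tree_segment r (s k)" and d: "disjoint_family_on s {1..n}"
  have "block_sum p {1..n} s x \<le> block_sum p {1..n} s y"
    unfolding block_sum_def using p le
    by (intro sum_mono powr_mono2) (auto intro!: sum_nonneg sum_mono simp: abs_le_square_iff)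
  also have "\<dots> \<le> JT_norm r p y powr p"
    using s d by (intro block_sum_le_JT_norm[OF y]) auto
  finally show "block_sum p {1..n} s x \<le> JT_norm r p y powr p" .
qed

lemma JT_norm_restrict: "x \<in> c00 \<Longrightarrow> JT_norm r p (restrict_seq A x) \<le> JT_norm r p x"
  by (intro JT_norm_mono c00_restrict) (auto simp: restrict_seq_def)

text \<open>A singleton is a segment. This estimate is what makes the coordinates
  continuous.\<close>

lemma abs_le_JT_norm:
  assumes x: "x \<in> c00" shows "\<bar>x i\<bar> \<le> JT_norm r p x"
proof (cases "i = 0")
  case True
  then show ?thesis
    using x JT_norm_nonneg[OF x] by (simp add: c00_def)
next
  case False
  then have "{i} = {k. (i, k) \<in> r \<and> (k, i) \<in> r}" "(i, i) \<in> r"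
    using r_refl r_antisym by auto
  then have "tree_segment r {i}"
    unfolding tree_segment_def by blast
  then have "block_sum p {()} (\<lambda>_. {i}) x \<le> JT_norm r p x powr p"
    by (intro block_sum_le_JT_norm[OF x]) (auto simp: disjoint_family_on_def)
  moreover have "block_sum p {()} (\<lambda>_. {i}) x = \<bar>x i\<bar> powr p"
  proof -
    have "(x i)\<^sup>2 = \<bar>x i\<bar> powr 2"
      by simp
    then show ?thesis
      using p by (simp add: block_sum_def powr_powr del: powr_numeral)
  qed
  ultimately show ?thesis
    using p JT_norm_nonneg[OF x] powr_less_mono2[of p "JT_norm r p x" "\<bar>x i\<bar>"] by fastforce
qed

section \<open>Upper 2-estimate, lower p-estimate and bounded completeness\<close>

lemma JT_norm_disjoint_upper:
  assumes x: "x \<in> c00" and y: "y \<in> c00" and disj: "\<And>i. x i * y i = 0"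
  shows "(JT_norm r p (\<lambda>i. x i + y i))\<^sup>2 \<le> (JT_norm r p x)\<^sup>2 + (JT_norm r p y)\<^sup>2"
proof -
  note xy = c00_add[OF x y]
  have sq: "((JT_norm r p z)\<^sup>2) powr (p / 2) = JT_norm r p z powr p" if "z \<in> c00" for z
    using JT_norm_nonneg[OF that] p by (simp add: powr_powr flip: powr_numeral)
  have "JT_norm r p (\<lambda>i. x i + y i) powr p \<le> ((JT_norm r p x)\<^sup>2 + (JT_norm r p y)\<^sup>2) powr (p / 2)"
  proof (rule JT_norm_powr_le[OF xy])
    fix n s assume s: "\<And>k. k \<in> {1..n::nat} \<Longrightarrow> tree_segment r (s k)" and d: "disjoint_family_on s {1..n}"
    \<comment> \<open>The cross terms vanish, so the square sums over each segment add. As vectors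
      indexed by the segments they have \<open>p / 2\<close>-norm at most the squared norms of
      \<open>x\<close> and \<open>y\<close>, and p/2 > 1 permits Minkowski.\<close>
    have "(x i + y i)\<^sup>2 = (x i)\<^sup>2 + (y i)\<^sup>2" for i
      using disj[of i] by (simp add: power2_sum)
    then have "block_sum p {1..n} s (\<lambda>i. x i + y i)
        = (\<Sum>k=1..n. ((\<Sum>i\<in>s k. (x i)\<^sup>2) + (\<Sum>i\<in>s k. (y i)\<^sup>2)) powr (p / 2))"
      by (simp add: block_sum_def sum.distrib)
    also have "\<dots> \<le> ((JT_norm r p x)\<^sup>2 + (JT_norm r p y)\<^sup>2) powr (p / 2)"
      using block_sum_le_JT_norm[OF x _ d] block_sum_le_JT_norm[OF y _ d] s p
      by (intro Minkowski_sum_le) (auto simp: sum_nonneg block_sum_def sq x y)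
    finally show "block_sum p {1..n} s (\<lambda>i. x i + y i)
        \<le> ((JT_norm r p x)\<^sup>2 + (JT_norm r p y)\<^sup>2) powr (p / 2)" .
  qed auto
  then have "((JT_norm r p (\<lambda>i. x i + y i))\<^sup>2) powr (p / 2)
      \<le> ((JT_norm r p x)\<^sup>2 + (JT_norm r p y)\<^sup>2) powr (p / 2)"
    by (simp add: sq xy)
  then show ?thesis
    using p powr_less_mono2[of "p / 2" "(JT_norm r p x)\<^sup>2 + (JT_norm r p y)\<^sup>2"
        "(JT_norm r p (\<lambda>i. x i + y i))\<^sup>2"] by fastforce
qed

text \<open>Norming segments of the two parts can be truncated to disjoint intervals and then combined
  into a single disjoint family.\<close>

lemma JT_norm_block_lower:
  assumes x: "x \<in> c00"
  shows "JT_norm r p (restrict_seq {..M} x) powr p + JT_norm r p (restrict_seq {M<..} x) powr p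
    \<le> JT_norm r p x powr p"
proof -
  let ?N = "JT_norm r p x powr p"
  let ?y = "restrict_seq {..M} x" and ?z = "restrict_seq {M<..} x"
  have y: "?y \<in> c00" and z: "?z \<in> c00"
    using x by (auto intro: c00_restrict)
  have mono: "JT_norm r p (restrict_seq A x) powr p \<le> ?N" for A
    using p JT_norm_restrict[OF x] JT_norm_nonneg[OF c00_restrict[OF x]] by (intro powr_mono2) auto
  have restr: "block_sum p {1..n} s (restrict_seq A x) = block_sum p {1..n} (\<lambda>k. s k \<inter> A) x"
    if s: "\<And>k. k \<in> {1..n::nat} \<Longrightarrow> tree_segment r (s k)" for n s A
  proof -
    have "(\<Sum>i\<in>s k. (restrict_seq A x i)\<^sup>2) = (\<Sum>i\<in>s k \<inter> A. (x i)\<^sup>2)" if k: "k \<in> {1..n}" for k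
    proof -
      have "finite (s k)"
        using finite_tree_segment[OF tree s[OF k]] .
      moreover have "(restrict_seq A x i)\<^sup>2 = (if i \<in> A then (x i)\<^sup>2 else 0)" for i
        by (simp add: restrict_seq_def)
      ultimately show ?thesis
        by (simp add: sum.inter_restrict)
    qed
    then show ?thesis
      by (simp add: block_sum_def)
  qed
  have both: "block_sum p {1..m} s ?y + block_sum p {1..n} t ?z \<le> ?N"
    if s: "\<And>k. k \<in> {1..m} \<Longrightarrow> tree_segment r (s k)" "disjoint_family_on s {1..m}"
      and t: "\<And>k. k \<in> {1..n} \<Longrightarrow> tree_segment r (t k)" "disjoint_family_on t {1..n}"
    for m n :: nat and s t
  proof -
    \<comment> \<open>The two families are indexed by a disjoint sum. Pieces from different families
      are disjoint because they lie on opposite sides of \<open>M\<close>.\<close>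
    define u where "u = case_sum (\<lambda>k. s k \<inter> {..M}) (\<lambda>k. t k \<inter> {M<..})"
    have "block_sum p {1..m} s ?y + block_sum p {1..n} t ?z = block_sum p ({1..m} <+> {1..n}) u x"
      using s(1) t(1) by (subst (1 2) restr) (auto simp: block_sum_def sum.Plus u_def)
    also have "\<dots> \<le> ?N"
    proof (rule block_sum_le_JT_norm[OF x])
      show "disjoint_family_on u ({1..m} <+> {1..n})"
      proof (unfold disjoint_family_on_def, intro ballI impI)
        fix k l
        assume "k \<in> {1..m} <+> {1..n}" "l \<in> {1..m} <+> {1..n}" "k \<noteq> l"
        then show "u k \<inter> u l = {}"
          using disjoint_family_onD[OF s(2)] disjoint_family_onD[OF t(2)]
          by (cases k; cases l) (fastforce simp: u_def)+
      qed
      show "u k = {} \<or> tree_segment r (u k)" if k: "k \<in> {1..m} <+> {1..n}" for k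
      proof (cases k)
        case (Inl l)
        then have "tree_segment r (s l)"
          using k s(1) by auto
        then show ?thesis
          using tree_segment_Int[of "s l" "{..M}"] by (auto simp: u_def Inl)
      next
        case (Inr l)
        then have "tree_segment r (t l)"
          using k t(1) by auto
        then show ?thesis
          using tree_segment_Int[of "t l" "{M<..}"] by (auto simp: u_def Inr)
      qed
    qed auto
    finally show ?thesis .
  qed
  \<comment> \<open>The two suprema are taken one after the other: first over \<open>t\<close> with
    \<open>s\<close> fixed, then over \<open>s\<close>.\<close>
  have "JT_norm r p ?y powr p \<le> ?N - JT_norm r p ?z powr p"
  proof (rule JT_norm_powr_le[OF y])
    fix m s assume s: "\<And>k. k \<in> {1..m::nat} \<Longrightarrow> tree_segment r (s k)" "disjoint_family_on s {1..m}"
    have "JT_norm r p ?z powr p \<le> ?N - block_sum p {1..m} s ?y"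
    proof (rule JT_norm_powr_le[OF z])
      show "0 \<le> ?N - block_sum p {1..m} s ?y"
        using block_sum_le_JT_norm[OF y finite_atLeastAtMost s(2)] s(1) mono[of "{..M}"] by force
      fix n t assume t: "\<And>k. k \<in> {1..n::nat} \<Longrightarrow> tree_segment r (t k)" "disjoint_family_on t {1..n}"
      have "block_sum p {1..m} s ?y + block_sum p {1..n} t ?z \<le> ?N"
        using s t by (intro both)
      then show "block_sum p {1..n} t ?z \<le> ?N - block_sum p {1..m} s ?y"
        by linarith
    qed
    then show "block_sum p {1..m} s ?y \<le> ?N - JT_norm r p ?z powr p"
      by linarith
  qed (use mono[of "{M<..}"] in linarith)
  then show ?thesis
    by simp
qed

text \<open>Otherwise infinitely many successive blocks would have norm at least \<epsilon>. By the
  lower p-estimate each adds \<epsilon>^p to the p-th power of the norm of a partial sequence, which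
  stays below C^p.\<close>

lemma JT_norm_boundedly_complete:
  assumes a0: "a 0 = 0" and bound: "\<And>N. JT_norm r p (restrict_seq {..N} a) \<le> C" and e: "\<epsilon> > 0"
  obtains M where "\<And>N. N \<ge> M \<Longrightarrow> JT_norm r p (restrict_seq {M<..N} a) < \<epsilon>"
proof (rule ccontr)
  assume "\<not> thesis"
  then have far: "\<exists>N\<ge>M. \<epsilon> \<le> JT_norm r p (restrict_seq {M<..N} a)" for M
    using that by (meson linorder_not_less)
  have "\<exists>N. real n * \<epsilon> powr p \<le> JT_norm r p (restrict_seq {..N} a) powr p" for n
  proof (induction n)
    case (Suc n)
    then obtain M where M: "real n * \<epsilon> powr p \<le> JT_norm r p (restrict_seq {..M} a) powr p"
      by blast
    obtain N where N: "N \<ge> M" "\<epsilon> \<le> JT_norm r p (restrict_seq {M<..N} a)"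
      using far by blast
    then have "\<epsilon> powr p \<le> JT_norm r p (restrict_seq {M<..N} a) powr p"
      using e p by (intro powr_mono2) auto
    moreover have "{..M} \<inter> {..N} = {..M}" "{M<..} \<inter> {..N} = {M<..N}"
      using N(1) by auto
    moreover have "restrict_seq {..N} a \<in> c00"
      using a0 by (rule c00_restrict_finite) simp
    ultimately have "real n * \<epsilon> powr p + \<epsilon> powr p \<le> JT_norm r p (restrict_seq {..N} a) powr p"
      using JT_norm_block_lower[of "restrict_seq {..N} a" M] M by (simp add: restrict_restrict)
    then show ?case
      by (auto simp: distrib_right add.commute)
  qed auto
  moreover have "JT_norm r p (restrict_seq {..N} a) powr p \<le> C powr p" for N
    using p bound JT_norm_nonneg[OF c00_restrict_finite[where x = a, OF a0]] by (intro powr_mono2) auto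
  ultimately have "real n * \<epsilon> powr p \<le> C powr p" for n
    by (meson order_trans)
  moreover obtain n where "C powr p / \<epsilon> powr p < real n"
    using reals_Archimedean2 by blast
  ultimately show False
    using e by (simp add: divide_less_eq) (meson linorder_not_less)
qed

end

section \<open>The completion\<close>

definition unit_seq :: "nat \<Rightarrow> nat \<Rightarrow> real" where
  "unit_seq n = (\<lambda>i. if i = n then 1 else 0)"

lemma c00_unit: "n \<ge> 1 \<Longrightarrow> unit_seq n \<in> c00"
  by (simp add: c00_def unit_seq_def)

locale james_tree_completion = james_tree +
  fixes J :: "(nat \<Rightarrow> real) \<Rightarrow> 'a::banach"
  assumes completion: "is_JT_completion r p J"
begin

lemma J_add: "x \<in> c00 \<Longrightarrow> y \<in> c00 \<Longrightarrow> J (\<lambda>i. x i + y i) = J x + J y"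
  and J_scale: "x \<in> c00 \<Longrightarrow> J (\<lambda>i. c * x i) = c *\<^sub>R J x"
  and norm_J: "x \<in> c00 \<Longrightarrow> norm (J x) = JT_norm r p x"
  and J_dense: "closure (J ` c00) = UNIV"
  using completion unfolding is_JT_completion_def by auto

lemma J_zero: "J (\<lambda>_. 0) = 0"
  using J_scale[OF c00_zero, of 0] by simp

lemma J_diff: "x \<in> c00 \<Longrightarrow> y \<in> c00 \<Longrightarrow> J (\<lambda>i. x i - y i) = J x - J y"
  using J_add[of x "\<lambda>i. (-1) * y i"] J_scale[of y "-1"] c00_scale[of y "-1"] by simp

section \<open>Extension from the dense subspace and the coordinate functionals\<close>

lemma dense_induct:
  assumes "closed {z. P z}" "\<And>x. x \<in> c00 \<Longrightarrow> P (J x)"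
  shows "P z"
proof -
  have "closure (J ` c00) \<subseteq> {z. P z}"
    using assms by (intro closure_minimal) auto
  then show ?thesis
    by (auto simp: J_dense)
qed

lemma blinfun_norm_le:
  fixes f :: "'a \<Rightarrow>\<^sub>L real"
  assumes C: "C \<ge> 0" and le: "\<And>x. x \<in> c00 \<Longrightarrow> \<bar>f (J x)\<bar> \<le> C * JT_norm r p x"
  shows "norm f \<le> C"
proof (rule norm_blinfun_bound[OF C])
  show "norm (f z) \<le> C * norm z" for z
    by (rule dense_induct[of "\<lambda>z. norm (f z) \<le> C * norm z"])
      (auto intro!: closed_Collect_le continuous_intros simp: le norm_J)
qed

text \<open>The n-th coordinate is 1-Lipschitz on the dense image of \<open>c00\<close>, so it
  extends continuously. Linearity and the norm bound are closed conditions and pass to the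
  limit.\<close>

lemma coord_exists: "\<exists>f :: 'a \<Rightarrow>\<^sub>L real. \<forall>x\<in>c00. f (J x) = x n"
proof -
  have coord_le: "\<bar>x n - y n\<bar> \<le> norm (J x - J y)" if "x \<in> c00" "y \<in> c00" for x y
    using abs_le_JT_norm[OF c00_diff[OF that], of n] that by (simp add: norm_J c00_diff flip: J_diff)
  \<comment> \<open>The choice of preimage is harmless: by \<open>coord_le\<close>, sequences with
    the same image under \<open>J\<close> share their n-th coordinate.\<close>
  define h where "h v = inv_into c00 J v n" for v
  have h: "h (J x) = x n" if "x \<in> c00" for x
  proof -
    have "inv_into c00 J (J x) \<in> c00" "J (inv_into c00 J (J x)) = J x"
      using that by (simp_all add: inv_into_into f_inv_into_f)
    then show ?thesis
      using coord_le[of "inv_into c00 J (J x)" x] that by (simp add: h_def)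
  qed
  have "1-lipschitz_on (J ` c00) h"
    by (rule lipschitz_onI) (auto simp: h dist_norm coord_le)
  then have "uniformly_continuous_on (J ` c00) h"
    by (rule lipschitz_on_uniformly_continuous)
  then obtain g where "uniformly_continuous_on UNIV g" and hg: "\<And>v. v \<in> J ` c00 \<Longrightarrow> h v = g v"
    using uniformly_continuous_on_extension_on_closure[of "J ` c00" h] J_dense by metis
  then have "continuous_on UNIV g"
    by (simp add: uniformly_continuous_imp_continuous)
  then have cont [continuous_intros]: "continuous_on S (\<lambda>x. g (w x))" if "continuous_on S w"
    for S and w :: "'a \<Rightarrow> 'a"
    using that continuous_on_compose2 by blast
  have g: "g (J x) = x n" if "x \<in> c00" for x
    using hg[of "J x"] h that by simp
  \<comment> \<open>Additivity is extended in one variable at a time.\<close>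
  have add1: "g (u + J y) = g u + g (J y)" if y: "y \<in> c00" for u y
    by (rule dense_induct[of "\<lambda>u. g (u + J y) = g u + g (J y)"])
      (auto intro!: closed_Collect_eq continuous_intros simp: y g c00_add simp flip: J_add)
  have add: "g (u + v) = g u + g v" for u v
    by (rule dense_induct[of "\<lambda>v. g (u + v) = g u + g v"])
      (auto intro!: closed_Collect_eq continuous_intros simp: add1)
  have scale: "g (c *\<^sub>R u) = c *\<^sub>R g u" for c u
    by (rule dense_induct[of "\<lambda>u. g (c *\<^sub>R u) = c *\<^sub>R g u"])
      (auto intro!: closed_Collect_eq continuous_intros simp: g c00_scale simp flip: J_scale)
  have "norm (g u) \<le> norm u * 1" for u
    by (rule dense_induct[of "\<lambda>u. norm (g u) \<le> norm u * 1"])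
      (auto intro!: closed_Collect_le continuous_intros simp: g norm_J abs_le_JT_norm)
  then have "bounded_linear g"
    by (intro bounded_linear_intro[where K = 1] add scale)
  then show ?thesis
    using g by (intro exI[of _ "Blinfun g"]) (simp add: bounded_linear_Blinfun_apply)
qed

definition coord :: "nat \<Rightarrow> 'a \<Rightarrow>\<^sub>L real" where
  "coord n = (SOME f. \<forall>x\<in>c00. blinfun_apply f (J x) = x n)"

lemma coord_J: "x \<in> c00 \<Longrightarrow> coord n (J x) = x n"
  using someI_ex[OF coord_exists[of n]] unfolding coord_def by blast

text \<open>Sequences in \<open>c00\<close> vanish at the dummy index 0. This makes the coefficient
  sequence of a bidual element vanish there too, so that its truncations lie in
  \<open>c00\<close>.\<close>

lemma coord_0: "coord 0 = 0"
proof -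
  have "norm (coord 0) \<le> 0"
    by (rule blinfun_norm_le) (auto simp: coord_J c00_def)
  then show ?thesis
    by simp
qed

section \<open>Tails of vectors and the shrinking property\<close>

lemma J_expand:
  assumes x: "x \<in> c00"
  shows "J x = (\<Sum>n=1..N. x n *\<^sub>R J (unit_seq n)) + J (restrict_seq {N<..} x)"
proof (induction N)
  case 0
  have "restrict_seq {0<..} x = x"
    using x by (auto simp: restrict_seq_def c00_def)
  then show ?case
    by simp
next
  case (Suc N)
  have "restrict_seq {N<..} x = (\<lambda>i. x (Suc N) * unit_seq (Suc N) i + restrict_seq {Suc N<..} x i)"
    by (rule ext) (auto simp: restrict_seq_def unit_seq_def not_less_eq intro!: arg_cong[of _ _ x])
  then have "J (restrict_seq {N<..} x) = x (Suc N) *\<^sub>R J (unit_seq (Suc N)) + J (restrict_seq {Suc N<..} x)"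
    using x by (simp add: J_add J_scale c00_scale c00_unit c00_restrict)
  then show ?case
    using Suc by (simp add: add.assoc)
qed

text \<open>If a functional stayed large on all tails, summing disjoint blocks would give a vector of norm
  at most \<open>\<surd>n\<close> on which it exceeds \<open>n \<epsilon>\<close>.\<close>

lemma shrinking:
  fixes f :: "'a \<Rightarrow>\<^sub>L real"
  assumes e: "\<epsilon> > 0"
  obtains N where "\<And>x. x \<in> c00 \<Longrightarrow> (\<And>i. i \<le> N \<Longrightarrow> x i = 0) \<Longrightarrow> \<bar>f (J x)\<bar> \<le> \<epsilon> * JT_norm r p x"
proof (rule ccontr)
  assume "\<not> thesis"
  then have large: "\<exists>x\<in>c00. (\<forall>i\<le>N. x i = 0) \<and> \<epsilon> * JT_norm r p x < \<bar>f (J x)\<bar>" for N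
    using that by (meson linorder_not_less)
  have normalised: "\<exists>x\<in>c00. (\<forall>i\<le>N. x i = 0) \<and> JT_norm r p x \<le> 1 \<and> \<epsilon> \<le> f (J x)" for N
  proof -
    obtain x where x: "x \<in> c00" "\<forall>i\<le>N. x i = 0" "\<epsilon> * JT_norm r p x < \<bar>f (J x)\<bar>"
      using large by blast
    have pos: "JT_norm r p x > 0"
    proof (rule ccontr)
      assume "\<not> ?thesis"
      then have "norm (J x) \<le> 0"
        using x(1) by (simp add: norm_J)
      then show False
        using x JT_norm_nonneg[OF x(1)] e by (auto simp flip: norm_J)
    qed
    \<comment> \<open>The sign makes the value of \<open>f\<close> positive, and the quotient
      normalises the vector.\<close>
    define c where "c = sgn (f (J x)) / JT_norm r p x"
    have "JT_norm r p (\<lambda>i. c * x i) = \<bar>c\<bar> * JT_norm r p x"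
      using x(1) by (simp add: J_scale c00_scale flip: norm_J)
    also have "\<dots> \<le> 1"
      using pos by (simp add: c_def abs_sgn_eq)
    finally have "JT_norm r p (\<lambda>i. c * x i) \<le> 1" .
    moreover have "f (J (\<lambda>i. c * x i)) = c * f (J x)"
      using x(1) by (simp add: J_scale blinfun.scaleR_right)
    then have "f (J (\<lambda>i. c * x i)) = \<bar>f (J x)\<bar> / JT_norm r p x"
      by (simp add: c_def abs_sgn mult.commute)
    then have "\<epsilon> \<le> f (J (\<lambda>i. c * x i))"
      using x(3) pos by (simp add: le_divide_eq)
    ultimately show ?thesis
      using x(1,2) by (intro bexI[of _ "\<lambda>i. c * x i"]) (auto simp: c00_scale)
  qed
  have "\<exists>x\<in>c00. (JT_norm r p x)\<^sup>2 \<le> real n \<and> real n * \<epsilon> \<le> f (J x)" for n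
  proof (induction n)
    case 0
    have "JT_norm r p (\<lambda>_. 0) = 0"
      using norm_J[OF c00_zero] by (simp add: J_zero)
    then show ?case
      using c00_zero by (intro bexI[of _ "\<lambda>_. 0"]) (auto simp: J_zero)
  next
    case (Suc n)
    then obtain x where x: "x \<in> c00" "(JT_norm r p x)\<^sup>2 \<le> real n" "real n * \<epsilon> \<le> f (J x)"
      by blast
    have "finite {i. x i \<noteq> 0}"
      using x(1) by (simp add: c00_def)
    \<comment> \<open>The next vector is chosen beyond the support of \<open>x\<close>, so the upper
      2-estimate applies.\<close>
    then obtain N where N: "\<forall>i\<in>{i. x i \<noteq> 0}. i \<le> N"
      using finite_nat_set_iff_bounded_le by blast
    obtain y where y: "y \<in> c00" "\<forall>i\<le>N. y i = 0" "JT_norm r p y \<le> 1" "\<epsilon> \<le> f (J y)"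
      using normalised by blast
    have "x i * y i = 0" for i
      using N y(2) by (cases "i \<le> N") auto
    then have "(JT_norm r p (\<lambda>i. x i + y i))\<^sup>2 \<le> (JT_norm r p x)\<^sup>2 + (JT_norm r p y)\<^sup>2"
      using x(1) y(1) by (intro JT_norm_disjoint_upper)
    also have "\<dots> \<le> real n + 1"
      using x(2) y(3) JT_norm_nonneg[OF y(1)] by (intro add_mono) (auto simp: power_le_one)
    finally show ?case
      using x y by (intro bexI[of _ "\<lambda>i. x i + y i"])
        (auto simp: c00_add J_add blinfun.add_right distrib_right)
  qed
  then obtain x where x: "\<And>n. x n \<in> c00" "\<And>n. (JT_norm r p (x n))\<^sup>2 \<le> real n"
    "\<And>n. real n * \<epsilon> \<le> f (J (x n))"
    by metis
  \<comment> \<open>Squaring n \<epsilon> \<le> |f| sqrt n and cancelling one factor n leaves a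
    left-hand side unbounded in n.\<close>
  have bound: "real n * \<epsilon>\<^sup>2 \<le> (norm f)\<^sup>2" if "n > 0" for n
  proof -
    have "real n * \<epsilon> \<le> norm f * JT_norm r p (x n)"
      using x(3)[of n] norm_blinfun[of f "J (x n)"] x(1) by (simp add: norm_J)
    then have "(real n * \<epsilon>)\<^sup>2 \<le> (norm f * JT_norm r p (x n))\<^sup>2"
      using e by (intro power_mono) auto
    also have "\<dots> \<le> (norm f)\<^sup>2 * real n"
      using x(2)[of n] by (simp add: power_mult_distrib mult_left_mono)
    finally have "real n * (real n * \<epsilon>\<^sup>2) \<le> real n * (norm f)\<^sup>2"
      by (simp add: power_mult_distrib power2_eq_square mult_ac)
    then show ?thesis
      using that by simp
  qed
  obtain n where n: "(norm f)\<^sup>2 / \<epsilon>\<^sup>2 < real n"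
    using reals_Archimedean2 by blast
  then have "(norm f)\<^sup>2 < real n * \<epsilon>\<^sup>2"
    using e by (simp add: divide_less_eq)
  moreover have "n > 0"
    using n order_le_less_trans[of 0 "(norm f)\<^sup>2 / \<epsilon>\<^sup>2" "real n"] by simp
  ultimately show False
    using bound[of n] by simp
qed

section \<open>Bidual elements: coefficients, density of the coordinate functionals,
  surjectivity\<close>

text \<open>For a family of segments \<open>s\<close>, with \<open>S k\<close> the sum of the squares of \<open>a\<close> over \<open>s k\<close>, the functional
  with coefficients \<open>S k powr (p/2 - 1) * a i\<close> for \<open>i \<in> s k\<close> attains the equality case of Hoelder's
  inequality at \<open>a\<close>.\<close>

lemma bidual_partial_sum_bound:
  fixes \<phi> :: "('a \<Rightarrow>\<^sub>L real) \<Rightarrow>\<^sub>L real"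
  defines "a \<equiv> \<lambda>n. \<phi> (coord n)"
  shows "JT_norm r p (restrict_seq {..N} a) \<le> norm \<phi>"
proof -
  define x where "x = restrict_seq {..N} a"
  have x: "x \<in> c00"
    unfolding x_def by (rule c00_restrict_finite) (simp_all add: a_def coord_0)
  have xa: "x i * a i = (x i)\<^sup>2" for i
    by (simp add: x_def restrict_seq_def power2_eq_square)
  have \<phi>_coord: "\<phi> (coord i) = a i" for i
    by (simp add: a_def)
  have "JT_norm r p x \<le> norm \<phi>"
  proof (rule JT_norm_le[OF x norm_ge_zero])
    fix n s assume s: "\<And>k. k \<in> {1..n::nat} \<Longrightarrow> tree_segment r (s k)" and d: "disjoint_family_on s {1..n}"
    define S where "S k = (\<Sum>i\<in>s k. (x i)\<^sup>2)" for k
    define T where "T = block_sum p {1..n} s x"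
    have S0: "S k \<ge> 0" for k
      by (simp add: S_def sum_nonneg)
    have T: "T = (\<Sum>k=1..n. S k powr (p / 2))"
      by (simp add: T_def block_sum_def S_def)
    define f where "f = (\<Sum>k=1..n. S k powr (p / 2 - 1) *\<^sub>R (\<Sum>i\<in>s k. x i *\<^sub>R coord i))"
    have "\<phi> f = (\<Sum>k=1..n. S k powr (p / 2 - 1) * S k)"
      by (simp add: f_def blinfun.sum_right blinfun.scaleR_right S_def \<phi>_coord xa)
    also have "\<dots> = T"
      unfolding T using S0 by (intro sum.cong refl) (simp add: powr_mult_base mult.commute)
    finally have \<phi>f: "\<phi> f = T" .
    \<comment> \<open>The exponent is the reciprocal of the conjugate exponent p/(p - 1).
      Cauchy-Schwarz is used inside each segment and Hoelder across the segments.\<close>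
    have "norm f \<le> T powr (1 - 1 / p)"
    proof (rule blinfun_norm_le)
      fix y assume y: "y \<in> c00"
      define R where "R k = (\<Sum>i\<in>s k. (y i)\<^sup>2)" for k
      have R0: "R k \<ge> 0" for k
        by (simp add: R_def sum_nonneg)
      have "f (J y) = (\<Sum>k=1..n. S k powr (p / 2 - 1) * (\<Sum>i\<in>s k. x i * y i))"
        by (simp add: f_def blinfun.sum_left blinfun.scaleR_left coord_J y)
      then have "\<bar>f (J y)\<bar> \<le> (\<Sum>k=1..n. S k powr (p / 2 - 1) * \<bar>\<Sum>i\<in>s k. x i * y i\<bar>)"
        by (simp add: order_trans[OF sum_abs] abs_mult)
      also have "\<dots> \<le> (\<Sum>k=1..n. S k powr (p / 2 - 1) * (S k powr (1 / 2) * R k powr (1 / 2)))"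
      proof (intro sum_mono mult_left_mono)
        fix k
        have "\<bar>\<Sum>i\<in>s k. x i * y i\<bar> = sqrt ((\<Sum>i\<in>s k. x i * y i)\<^sup>2)"
          by simp
        also have "\<dots> \<le> sqrt (S k * R k)"
          unfolding S_def R_def by (intro real_sqrt_le_mono Cauchy_Schwarz_ineq_sum)
        finally show "\<bar>\<Sum>i\<in>s k. x i * y i\<bar> \<le> S k powr (1 / 2) * R k powr (1 / 2)"
          using S0 R0 by (simp add: powr_half_sqrt real_sqrt_mult)
      qed auto
      also have "\<dots> = (\<Sum>k=1..n. S k powr ((p - 1) / 2) * R k powr (1 / 2))"
        by (simp add: mult.assoc[symmetric] powr_add[symmetric] diff_divide_distrib)
      \<comment> \<open>Since (p - 1)/2 times p/(p - 1) is p/2, the first factor becomes a power of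
        \<open>T\<close>. The second is controlled by the norm of \<open>y\<close>.\<close>
      also have "\<dots> \<le> (\<Sum>k=1..n. (S k powr ((p - 1) / 2)) powr (p / (p - 1))) powr (1 / (p / (p - 1)))
          * (\<Sum>k=1..n. (R k powr (1 / 2)) powr p) powr (1 / p)"
        using p by (intro Holder_sum) (auto simp: field_simps)
      also have "\<dots> = T powr (1 - 1 / p) * block_sum p {1..n} s y powr (1 / p)"
      proof -
        have "(p - 1) / 2 * (p / (p - 1)) = p / 2" "1 / (p / (p - 1)) = 1 - 1 / p"
          using p by (simp_all add: field_simps)
        then show ?thesis
          by (simp only: powr_powr T block_sum_def R_def) simp
      qed
      also have "\<dots> \<le> T powr (1 - 1 / p) * (JT_norm r p y powr p) powr (1 / p)"
        using p s by (intro mult_left_mono powr_mono2 block_sum_le_JT_norm y d) (auto simp: block_sum_nonneg)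
      finally show "\<bar>f (J y)\<bar> \<le> T powr (1 - 1 / p) * JT_norm r p y"
        using p JT_norm_nonneg[OF y] by (simp add: powr_powr)
    qed auto
    then have Tle: "T \<le> norm \<phi> * T powr (1 - 1 / p)"
      using norm_blinfun[of \<phi> f] mult_left_mono[of "norm f" "T powr (1 - 1 / p)" "norm \<phi>"]
      unfolding \<phi>f by simp
    have T0: "T \<ge> 0"
      by (simp add: T_def block_sum_nonneg)
    \<comment> \<open>If \<open>T\<close> is nonzero, cancelling \<open>T powr (1 - 1 / p)\<close>
      in \<open>Tle\<close> leaves \<open>T powr (1 / p) \<le> norm \<phi>\<close>.\<close>
    have "T \<le> norm \<phi> powr p"
    proof (cases "T = 0")
      case False
      then have "T powr (1 / p) * T powr (1 - 1 / p) = T"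
        using T0 by (simp flip: powr_add)
      then have "T powr (1 / p) \<le> norm \<phi>"
        using Tle False T0 by (metis mult_le_cancel_right powr_gt_zero not_less)
      then have "(T powr (1 / p)) powr p \<le> norm \<phi> powr p"
        using p by (intro powr_mono2) auto
      then show ?thesis
        using p T0 by (simp add: powr_powr)
    qed simp
    then show "block_sum p {1..n} s x \<le> norm \<phi> powr p"
      by (simp add: T_def)
  qed
  then show ?thesis
    by (simp add: x_def)
qed

text \<open>The shrinking property makes the span of the coordinate functionals dense in the dual:
  subtracting from \<open>f\<close> its first N coordinate terms leaves \<open>f\<close> applied to
  the tail, which has small norm.\<close>

lemma bidual_eqI:
  fixes \<psi> :: "('a \<Rightarrow>\<^sub>L real) \<Rightarrow>\<^sub>L real"
  assumes coord: "\<And>n. \<psi> (coord n) = 0"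
  shows "\<psi> = 0"
proof (rule blinfun_eqI)
  fix f
  have "\<bar>\<psi> f\<bar> \<le> norm \<psi> * \<epsilon>" if e: "\<epsilon> > 0" for \<epsilon>
  proof -
    obtain N where N: "\<And>x. x \<in> c00 \<Longrightarrow> (\<And>i. i \<le> N \<Longrightarrow> x i = 0) \<Longrightarrow> \<bar>f (J x)\<bar> \<le> \<epsilon> * JT_norm r p x"
      using shrinking[OF e] by blast
    define g where "g = f - (\<Sum>n=1..N. f (J (unit_seq n)) *\<^sub>R coord n)"
    have "norm g \<le> \<epsilon>"
    proof (rule blinfun_norm_le)
      fix x assume x: "x \<in> c00"
      have "f (J x) = (\<Sum>n=1..N. x n * f (J (unit_seq n))) + f (J (restrict_seq {N<..} x))"
        unfolding J_expand[OF x, of N] by (simp add: blinfun.add_right blinfun.sum_right blinfun.scaleR_right)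
      then have "g (J x) = f (J (restrict_seq {N<..} x))"
        by (simp add: g_def blinfun.diff_left blinfun.sum_left blinfun.scaleR_left coord_J[OF x] mult.commute)
      moreover have "\<bar>f (J (restrict_seq {N<..} x))\<bar> \<le> \<epsilon> * JT_norm r p (restrict_seq {N<..} x)"
        using x by (intro N c00_restrict) (auto simp: restrict_seq_def)
      moreover have "\<dots> \<le> \<epsilon> * JT_norm r p x"
        using e JT_norm_restrict[OF x] by (intro mult_left_mono) auto
      ultimately show "\<bar>g (J x)\<bar> \<le> \<epsilon> * JT_norm r p x"
        by linarith
    qed (use e in simp)
    moreover have "\<psi> f = \<psi> g"
      by (simp add: g_def blinfun.diff_right blinfun.sum_right blinfun.scaleR_right coord)
    ultimately show ?thesis
      using norm_blinfun[of \<psi> g] mult_left_mono[of "norm g" \<epsilon> "norm \<psi>"] by simp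
  qed
  note bound = this
  have "\<bar>\<psi> f\<bar> \<le> 0 + e" if "e > 0" for e
  proof -
    \<comment> \<open>Adding 1 in the denominator avoids a division by zero.\<close>
    have "\<bar>\<psi> f\<bar> \<le> norm \<psi> * (e / (norm \<psi> + 1))"
      using that by (intro bound divide_pos_pos) (auto intro: add_nonneg_pos)
    also have "\<dots> \<le> e"
      using that norm_ge_zero[of \<psi>] by (simp add: divide_le_eq add_nonneg_pos distrib_left mult.commute)
    finally show ?thesis
      by simp
  qed
  then have "\<bar>\<psi> f\<bar> \<le> 0"
    by (rule field_le_epsilon)
  then show "\<psi> f = blinfun_apply 0 f"
    by simp
qed

lemma surj_canonical_embedding: "surj (canonical_embedding :: 'a \<Rightarrow> ('a \<Rightarrow>\<^sub>L real) \<Rightarrow>\<^sub>L real)"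
proof -
  have "\<exists>x. \<phi> = canonical_embedding x" for \<phi> :: "('a \<Rightarrow>\<^sub>L real) \<Rightarrow>\<^sub>L real"
  proof -
    define a where "a n = \<phi> (coord n)" for n
    have a0: "a 0 = 0"
      by (simp add: a_def coord_0)
    have c00_a: "restrict_seq A a \<in> c00" if "finite A" for A
      using a0 that by (rule c00_restrict_finite)
    define z where "z N = J (restrict_seq {..N} a)" for N
    have z_diff: "norm (z N - z M) = JT_norm r p (restrict_seq {M<..N} a)" if "M \<le> N" for M N
    proof -
      have "restrict_seq {M<..N} a = (\<lambda>i. restrict_seq {..N} a i - restrict_seq {..M} a i)"
        using that by (auto simp: restrict_seq_def)
      then show ?thesis
        by (simp add: z_def c00_a c00_diff J_diff flip: norm_J)
    qed
    have bound: "JT_norm r p (restrict_seq {..N} a) \<le> norm \<phi>" for N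
      unfolding a_def by (rule bidual_partial_sum_bound)
    \<comment> \<open>The partial sums have norm at most \<open>norm \<phi>\<close>, so bounded
      completeness makes the blocks after a suitable \<open>M\<close> small. Both terms are compared
      with \<open>z M\<close>.\<close>
    have "Cauchy z"
    proof (rule CauchyI')
      fix \<epsilon> :: real assume "\<epsilon> > 0"
      then obtain M where M: "\<And>N. N \<ge> M \<Longrightarrow> JT_norm r p (restrict_seq {M<..N} a) < \<epsilon> / 2"
        using JT_norm_boundedly_complete[OF a0 bound, of "\<epsilon> / 2"] by (meson half_gt_zero)
      have "dist (z m) (z n) < \<epsilon>" if "m \<ge> M" "n > m" for m n
      proof -
        have "dist (z m) (z M) < \<epsilon> / 2" "dist (z n) (z M) < \<epsilon> / 2"
          using M that by (auto simp: dist_norm z_diff)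
        then show ?thesis
          by (rule dist_triangle_half_l)
      qed
      then show "\<exists>M. \<forall>m\<ge>M. \<forall>n>m. dist (z m) (z n) < \<epsilon>"
        by blast
    qed
    then obtain x where x: "z \<longlonglongrightarrow> x"
      by (auto simp: Cauchy_convergent_iff convergent_def)
    have coord_x: "coord n x = a n" for n
    proof (rule LIMSEQ_unique)
      show "(\<lambda>N. coord n (z N)) \<longlonglongrightarrow> coord n x"
        using x by (intro tendsto_intros)
      \<comment> \<open>The n-th coordinate of the partial sums is constant from N = n on, and this
        identifies the coefficients of the limit.\<close>
      have "coord n (z N) = a n" if "N \<ge> n" for N
        using that by (simp add: z_def coord_J c00_a) (simp add: restrict_seq_def)
      then show "(\<lambda>N. coord n (z N)) \<longlonglongrightarrow> a n"
        by (intro tendsto_eventually eventually_sequentiallyI)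
    qed
    have "\<phi> - canonical_embedding x = 0"
      by (rule bidual_eqI) (simp add: blinfun.diff_left coord_x a_def)
    then show ?thesis
      by (intro exI[of _ x]) simp
  qed
  then show ?thesis
    by (auto simp: surj_def)
qed

end

theorem corollary1p3p13:
  fixes r :: "nat rel" and p :: real and J :: "(nat \<Rightarrow> real) \<Rightarrow> 'a::banach"
  assumes "infinitely_branching_rootless_tree r"
    and "2 < p"
    and "is_JT_completion r p J"
  shows "reflexive_space TYPE('a)"
proof -
  interpret james_tree_completion r p J
    using assms by unfold_locales
  show ?thesis
    unfolding reflexive_space_def by (rule surj_canonical_embedding)
qed

end
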